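(* Let $p$ and $q$ be distinct primes satisfying $p \equiv 33 \pmod{40}$ and $q \equiv 7 \pmod{40}$. Then the rank of the elliptic curve $E_{pq}: y^2 = x^3 - 5pqx$ over $\mathbb{Q}$ is zero.
   Context: For an elliptic curve $E$ over a number field $\mathbb{K}$, the rank of $E$ over $\mathbb{K}$ is the integer $r \ge 0$ such that $E(\mathbb{K}) \cong \mathbb{Z}^r \oplus E(\mathbb{K})_{tors}$ (Mordell-Weil). *)

theory Defs
  imports
    "HOL-Algebra.Product_Groups"
    "HOL-Computational_Algebra.Primes"
    "HOL-Number_Theory.Cong"
begin

text \<open>
  Elliptic curves in short Weierstrass form \<open>y\<^sup>2 = x\<^sup>3 + a x + b\<close>
  over a field of characteristic zero. \<open>Infinity\<close> is the point at infinity,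
  the only point of the projective closure that is not affine.
\<close>

definition nonsingular_curve :: "'a::field_char_0 \<Rightarrow> 'a \<Rightarrow> bool" where
  "nonsingular_curve a b \<longleftrightarrow> 4 * a ^ 3 + 27 * b ^ 2 \<noteq> 0"

datatype 'a ec_point = Infinity | Affine 'a 'a

definition ec_points :: "'a::field_char_0 \<Rightarrow> 'a \<Rightarrow> 'a ec_point set" where
  "ec_points a b = insert Infinity {Affine x y | x y. y ^ 2 = x ^ 3 + a * x + b}"

text \<open>
  The chord-and-tangent law. On the curve, two points with the same \<open>x\<close> are
  either opposite or equal; in the remaining cases \<open>s\<close> is the slope of the chord,
  respectively of the tangent. The coefficient \<open>b\<close> does not enter the formulas.
\<close>

fun ec_add :: "'a::field_char_0 \<Rightarrow> 'a ec_point \<Rightarrow> 'a ec_point \<Rightarrow> 'a ec_point" where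
  "ec_add a Infinity Q = Q"
| "ec_add a (Affine x1 y1) Infinity = Affine x1 y1"
| "ec_add a (Affine x1 y1) (Affine x2 y2) =
     (if x1 = x2 \<and> y1 = - y2 then Infinity
      else
        let s = (if x1 = x2 then (3 * x1 ^ 2 + a) / (2 * y1) else (y2 - y1) / (x2 - x1));
            x3 = s ^ 2 - x1 - x2
        in Affine x3 (s * (x1 - x3) - y1))"

definition ec_group :: "'a::field_char_0 \<Rightarrow> 'a \<Rightarrow> 'a ec_point monoid" where
  "ec_group a b = \<lparr>carrier = ec_points a b, monoid.mult = ec_add a, one = Infinity\<rparr>"

definition torsion_part :: "'g monoid \<Rightarrow> 'g monoid" where
  "torsion_part G =
     G\<lparr>carrier := {x \<in> carrier G. \<exists>n::nat. n > 0 \<and> x [^]\<^bsub>G\<^esub> n = \<one>\<^bsub>G\<^esub>}\<rparr>"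

text \<open>
  The value is meaningful for finitely generated abelian groups, where such an
  \<open>r\<close> exists and is unique; for groups of points over number fields this is
  the Mordell-Weil theorem.
\<close>

definition group_rank :: "'g monoid \<Rightarrow> nat" where
  "group_rank G =
     (THE r. G \<cong> product_group {..<r} (\<lambda>_. integer_group) \<times>\<times> torsion_part G)"

definition ec_rank :: "'a::field_char_0 \<Rightarrow> 'a \<Rightarrow> nat" where
  "ec_rank a b = group_rank (ec_group a b)"

lemma nonsingular_curve_zero_right [simp]: "nonsingular_curve a 0 \<longleftrightarrow> a \<noteq> 0"
  by (simp add: nonsingular_curve_def)

lemma ec_add_closed:
  assumes "P \<in> ec_points a b" and "Q \<in> ec_points a b"
  shows "ec_add a P Q \<in> ec_points a b"
proof (cases "P = Infinity \<or> Q = Infinity")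
  case True
  then show ?thesis using assms by (cases P; cases Q) auto
next
  case False
  then obtain x1 y1 x2 y2 where PQ: "P = Affine x1 y1" "Q = Affine x2 y2"
    by (metis ec_point.exhaust)
  have 1: "y1 ^ 2 = x1 ^ 3 + a * x1 + b" and 2: "y2 ^ 2 = x2 ^ 3 + a * x2 + b"
    using assms by (auto simp: PQ ec_points_def)
  show ?thesis
  proof (cases "x1 = x2 \<and> y1 = - y2")
    case True
    then show ?thesis by (simp add: PQ ec_points_def)
  next
    case nopp: False
    define s where
      "s = (if x1 = x2 then (3 * x1 ^ 2 + a) / (2 * y1) else (y2 - y1) / (x2 - x1))"
    define x3 where "x3 = s ^ 2 - x1 - x2"
    have "(s * (x1 - x3) - y1) ^ 2 = x3 ^ 3 + a * x3 + b"
    proof (cases "x1 = x2")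
      case True
      with 1 2 have "y1 ^ 2 = y2 ^ 2" by simp
      with True nopp have "y1 = y2" by (auto simp: power2_eq_iff)
      with True nopp have "y1 \<noteq> 0" by auto
      with True have "s * (2 * y1) = 3 * x1 ^ 2 + a" by (simp add: s_def)
      with 1 True x3_def show ?thesis by algebra
    next
      case False
      then have s: "s * (x2 - x1) = y2 - y1" by (simp add: s_def)
      have "(x2 - x1) * ((s * (x1 - x3) - y1) ^ 2 - (x3 ^ 3 + a * x3 + b)) = 0"
        using 1 2 s x3_def by algebra
      with False show ?thesis by simp
    qed
    with nopp show ?thesis
      by (auto simp: PQ ec_points_def Let_def s_def x3_def)
  qed
qed

end

theory Submission
  imports
    Defs
    "HOL-Number_Theory.Quadratic_Reciprocity"
    "HOL-Computational_Algebra.Nth_Powers"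
    "HOL-Computational_Algebra.Squarefree"
begin

text \<open>
  The only rational points on \<open>y\<^sup>2 = x\<^sup>3 - N x\<close>, \<open>N = 5pq\<close>, are infinity and \<open>(0, 0)\<close>; this is
  descent by 2-isogeny made elementary. A point with \<open>x \<noteq> 0\<close> gives \<open>D M = N\<close> and coprime nonzero
  \<open>a\<close>, \<open>e\<close> with \<open>w\<^sup>2 = \<plusminus>(D a\<^sup>4 - M e\<^sup>4)\<close>. Modulo 5, \<open>p\<close> or \<open>q\<close> this is unsolvable unless it has the
  form \<open>w\<^sup>2 = a\<^sup>4 - N e\<^sup>4\<close>. As \<open>N\<close> is 3 modulo 8, \<open>e\<close> is then even, and factoring \<open>a\<^sup>4 - w\<^sup>2\<close> gives
  \<open>a\<^sup>2 = D s\<^sup>4 + 4 M t\<^sup>4\<close> with \<open>s t = e / 2\<close> up to sign, where again only \<open>D = 1\<close> is locally solvable. Factoring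
  \<open>a\<^sup>2 - s\<^sup>4 = 4 N t\<^sup>4\<close> leads back to \<open>s\<^sup>2 = v\<^sup>4 - N u\<^sup>4\<close> with \<open>u v = t\<close> up to sign, so \<open>u\<close> is smaller
  than \<open>e\<close> in absolute value, and infinite descent applies.
\<close>

lemma group_rank_eq_0_if_torsion:
  assumes "group G"
    and tors: "\<And>x. x \<in> carrier G \<Longrightarrow> \<exists>n::nat. n > 0 \<and> x [^]\<^bsub>G\<^esub> n = \<one>\<^bsub>G\<^esub>"
  shows "group_rank G = 0"
  unfolding group_rank_def
proof (rule the_equality)
  interpret group G by fact
  have "{x \<in> carrier G. \<exists>n::nat. n > 0 \<and> x [^]\<^bsub>G\<^esub> n = \<one>\<^bsub>G\<^esub>} = carrier G"
    using tors by blast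
  then have eq: "torsion_part G = G"
    by (simp add: torsion_part_def)
  show "G \<cong> product_group {..<0::nat} (\<lambda>_. integer_group) \<times>\<times> torsion_part G"
    unfolding eq
  proof (rule is_isoI, rule isoI)
    let ?h = "\<lambda>x. (\<lambda>_. undefined, x)"
    let ?Z = "product_group {..<0::nat} (\<lambda>_. integer_group)"
    have carrier_eq: "carrier (?Z \<times>\<times> G) = {\<lambda>_. undefined} \<times> carrier G"
      by (simp add: DirProd_def)
    show "?h \<in> hom G (?Z \<times>\<times> G)"
    proof (rule homI)
      fix x y
      assume "x \<in> carrier G" "y \<in> carrier G"
      show "?h (x \<otimes>\<^bsub>G\<^esub> y) = ?h x \<otimes>\<^bsub>?Z \<times>\<times> G\<^esub> ?h y"
        by (simp add: DirProd_def restrict_def)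
    qed (simp add: carrier_eq)
    show "bij_betw ?h (carrier G) (carrier (?Z \<times>\<times> G))"
      unfolding carrier_eq by (auto simp: bij_betw_def inj_on_def)
  qed
next
  interpret group G by fact
  fix r :: nat
  let ?Z = "product_group {..<r} (\<lambda>_. integer_group)"
  assume "G \<cong> ?Z \<times>\<times> torsion_part G"
  then obtain h where h: "h \<in> iso G (?Z \<times>\<times> torsion_part G)"
    by (auto simp: is_iso_def)
  show "r = 0"
  proof (rule ccontr)
    assume "r \<noteq> 0"
    define f where "f x = fst (h x) 0" for x
    have f_mult: "f (x \<otimes>\<^bsub>G\<^esub> y) = f x + f y" if "x \<in> carrier G" "y \<in> carrier G" for x y
    proof -
      have "h (x \<otimes>\<^bsub>G\<^esub> y) = h x \<otimes>\<^bsub>?Z \<times>\<times> torsion_part G\<^esub> h y"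
        using h that by (simp add: iso_def hom_mult)
      then show ?thesis
        using \<open>r \<noteq> 0\<close> by (auto simp: f_def DirProd_def split_beta)
    qed
    from f_mult[of "\<one>\<^bsub>G\<^esub>" "\<one>\<^bsub>G\<^esub>"] have f_one: "f \<one>\<^bsub>G\<^esub> = 0" by simp
    have f_pow: "f (x [^]\<^bsub>G\<^esub> n) = int n * f x" if "x \<in> carrier G" for x and n :: nat
      using that by (induction n) (auto simp: f_one f_mult algebra_simps)
    have f_zero: "f x = 0" if x: "x \<in> carrier G" for x
    proof -
      obtain n :: nat where n: "n > 0" "x [^]\<^bsub>G\<^esub> n = \<one>\<^bsub>G\<^esub>"
        using tors[OF x] by blast
      with f_pow[OF x, of n] have "int n * f x = 0" using f_one by metis
      with n(1) show ?thesis by simp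
    qed
    define z :: "nat \<Rightarrow> int" where "z = (\<lambda>i\<in>{..<r}. 1)"
    have "(z, \<one>\<^bsub>G\<^esub>) \<in> carrier (?Z \<times>\<times> torsion_part G)"
      by (auto simp: z_def DirProd_def torsion_part_def intro!: exI[of _ 1])
    moreover have "h ` carrier G = carrier (?Z \<times>\<times> torsion_part G)"
      using h by (simp only: iso_def bij_betw_def mem_Collect_eq)
    ultimately obtain x where "x \<in> carrier G" "h x = (z, \<one>\<^bsub>G\<^esub>)"
      by (metis (no_types, lifting) imageE)
    then show False
      using f_zero[of x] \<open>r \<noteq> 0\<close> by (simp add: f_def z_def)
  qed
qed

lemma coprime_mult_eq_mult_power_nat:
  fixes X Y N t :: nat
  assumes "coprime X Y" "X * Y = N * t ^ n" "X > 0" "Y > 0" "n > 0"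
  shows "\<exists>D M u v. D * M = N \<and> X = D * u ^ n \<and> Y = M * v ^ n \<and> u * v = t"
proof -
  have "N dvd X * Y" using assms by simp
  then obtain D M where N: "N = D * M" "D dvd X" "M dvd Y"
    using division_decomp by blast
  then obtain x y where xy: "X = D * x" "Y = M * y" by (auto elim!: dvdE)
  have pos: "D > 0" "M > 0" "x > 0" "y > 0" using assms xy by auto
  have t: "x * y = t ^ n"
    using assms(2) pos N(1) xy by simp
  have "coprime x y" using assms(1) xy by simp
  moreover have "is_nth_power n (x * y)" unfolding t by simp
  ultimately have "is_nth_power n x" "is_nth_power n y"
    using is_nth_power_mult_coprime_natD pos by blast+
  then obtain u v where uv: "x = u ^ n" "y = v ^ n" by (auto elim!: is_nth_powerE)
  have "(u * v) ^ n = t ^ n" using t uv by (simp add: power_mult_distrib)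
  then have "u * v = t" using assms(5) power_eq_iff_eq_base by blast
  with N xy uv show ?thesis by blast
qed

lemma coprime_mult_eq_mult_power_int:
  fixes X Y N t :: int
  assumes "coprime X Y" "X * Y = N * t ^ n" "X > 0" "Y > 0" "n > 0" "N > 0" "t \<ge> 0"
  obtains D M u v where "D * M = N" "X = D * u ^ n" "Y = M * v ^ n" "u * v = t"
    "D > 0" "M > 0" "u \<ge> 0" "v \<ge> 0"
proof -
  have "coprime (nat X) (nat Y)"
    using assms by (simp add: coprime_int_iff[symmetric])
  moreover have "nat X * nat Y = nat N * nat t ^ n"
    using assms by (metis nat_mult_distrib nat_power_eq order_less_imp_le)
  ultimately obtain D M u v where *: "D * M = nat N" "nat X = D * u ^ n" "nat Y = M * v ^ n" "u * v = nat t"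
    using coprime_mult_eq_mult_power_nat[of "nat X" "nat Y" "nat N" "nat t" n] assms by auto
  have "int D * int M = N" "X = int D * int u ^ n" "Y = int M * int v ^ n" "int u * int v = t"
    using assms(3,4,6,7) * by (simp_all flip: of_nat_mult of_nat_power)
  moreover from this(1) assms(6) have "int D > 0" "int M > 0"
    by (auto simp flip: of_nat_mult intro!: Nat.gr0I)
  ultimately show ?thesis using that[of "int D" "int M" "int u" "int v"] by auto
qed

lemma coprime_mult_eq_square_int:
  fixes X Y t :: int
  assumes "coprime X Y" "X * Y = t\<^sup>2" "X > 0" "Y > 0"
  obtains u v where "X = u\<^sup>2" "Y = v\<^sup>2"
proof -
  obtain D M u v where "D * M = 1" "D > 0" "X = D * u\<^sup>2" "Y = M * v\<^sup>2"
    by (rule coprime_mult_eq_mult_power_int[of X Y 1 "\<bar>t\<bar>" 2]) (use assms in auto)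
  then show ?thesis using that by (auto simp: pos_zmult_eq_1_iff)
qed

lemma no_quartic_if_nonresidue:
  fixes w D a l c e :: int
  assumes "prime l" "w\<^sup>2 = D * a ^ 4 + l * c * e ^ 4" "coprime a e" "\<not> l dvd c" "\<not> QuadRes l D"
  shows False
proof (cases "l dvd a")
  case True
  then have "l\<^sup>2 dvd a ^ 4" 
    using dvd_trans[OF le_imp_power_dvd dvd_power_same, of 2 4 l a] by simp
  have "l dvd a ^ 4" using True assms(1) by (simp add: prime_dvd_power_iff)
  then have "l dvd w\<^sup>2" using assms(2) by (simp add: mult.assoc)
  then have "l dvd w" using assms(1) prime_dvd_power by blast
  then have "l\<^sup>2 dvd w\<^sup>2" by simp
  then have "l\<^sup>2 dvd w\<^sup>2 - D * a ^ 4" using \<open>l\<^sup>2 dvd a ^ 4\<close> by (simp add: dvd_diff)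
  then have "l * l dvd l * (c * e ^ 4)" using assms(2) by (simp add: power2_eq_square algebra_simps)
  then have "l dvd c * e ^ 4" using assms(1) by (simp add: prime_gt_0_int)
  then have "l dvd e" using assms(1,4) by (meson prime_dvd_mult_iff prime_dvd_power)
  with True assms(1,3) show False by (meson coprime_common_divisor not_prime_unit)
next
  case False
  then have "coprime l a" using assms(1) by (simp add: prime_imp_coprime)
  then obtain b where b: "[a * b = 1] (mod l)"
    using cong_solve_coprime_int[of a l] by (auto simp: coprime_commute)
  have "[(w * b\<^sup>2)\<^sup>2 = D * (a * b) ^ 4] (mod l)"
  proof -
    have "(w * b\<^sup>2)\<^sup>2 = w\<^sup>2 * b ^ 4"
      by (simp add: power_mult_distrib flip: power_mult)
    also have "\<dots> = D * (a * b) ^ 4 + l * (c * e ^ 4 * b ^ 4)"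
      unfolding assms(2) by (simp add: power_mult_distrib algebra_simps)
    finally have "(w * b\<^sup>2)\<^sup>2 = D * (a * b) ^ 4 + l * (c * e ^ 4 * b ^ 4)" .
    then show ?thesis by (simp add: cong_def)
  qed
  also have "[D * (a * b) ^ 4 = D * 1 ^ 4] (mod l)"
    using b by (intro cong_mult cong_pow) auto
  finally have "[(w * b\<^sup>2)\<^sup>2 = D] (mod l)" by simp
  then have "QuadRes l D" unfolding QuadRes_def by blast
  with assms(5) show False by simp
qed

lemma coprime_if_squarefree:
  fixes X Y N t :: int
  assumes "squarefree N" "X * Y = N * t" "coprime (X + Y) t \<or> coprime (Y - X) t"
  shows "coprime X Y"
proof (rule ccontr)
  assume "\<not> coprime X Y"
  then obtain l where l: "prime l" "l dvd X" "l dvd Y"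
    using prime_factor_int[of "gcd X Y"] by (auto simp: coprime_iff_gcd_eq_1)
  have "l * l dvd X * Y" using l by (intro mult_dvd_mono)
  then have *: "l\<^sup>2 dvd N * t" using assms(2) by (simp add: power2_eq_square)
  have "\<not> l dvd t"
  proof
    assume "l dvd t"
    moreover have "l dvd X + Y" "l dvd Y - X" using l by auto
    ultimately show False using assms(3) l(1) by (meson coprime_common_divisor not_prime_unit)
  qed
  then have "coprime (l\<^sup>2) t" using l(1) by (simp add: prime_imp_coprime)
  with * have "l\<^sup>2 dvd N" by (simp add: coprime_dvd_mult_left_iff)
  with assms(1) l(1) show False by (meson not_prime_unit squarefreeD)
qed

lemma quartic_from_cubic:
  fixes X Z N k \<sigma> :: int
  assumes eq: "Z * (X * (\<sigma> * (X\<^sup>2 - N * Z\<^sup>2))) = k\<^sup>2" and "k \<noteq> 0" "X > 0" "Z > 0" "N > 0"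
    and "coprime X Z" and \<sigma>: "\<sigma> = 1 \<or> \<sigma> = -1"
  obtains D M a e w where "D * M = N" "D > 0" "M > 0" "coprime a e" "a \<noteq> 0" "e \<noteq> 0" "w\<^sup>2 = \<sigma> * (D * a ^ 4 - M * e ^ 4)"
proof -
  define W where "W = \<sigma> * (X\<^sup>2 - N * Z\<^sup>2)"
  have ZXW: "(Z * X) * W = k\<^sup>2" using eq by (simp add: W_def mult.assoc)
  have "0 < k\<^sup>2" using \<open>k \<noteq> 0\<close> by simp
  then have "W > 0"
    using ZXW assms(3,4) by (metis zero_less_mult_pos mult_pos_pos)
  have "coprime Z (X\<^sup>2 - N * Z\<^sup>2)"
  proof -
    have "gcd Z (X\<^sup>2 - N * Z\<^sup>2) = gcd Z (X\<^sup>2)"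
      using gcd_add_mult[of Z "- N * Z" "X\<^sup>2"] by (simp add: power2_eq_square algebra_simps)
    moreover have "coprime Z (X\<^sup>2)" using \<open>coprime X Z\<close> by (simp add: coprime_commute)
    ultimately show ?thesis by (simp only: coprime_iff_gcd_eq_1)
  qed
  then have "coprime Z (X * W)"
    using \<sigma> \<open>coprime X Z\<close> by (auto simp: W_def coprime_commute)
  moreover have "Z * (X * W) = k\<^sup>2" using ZXW by (simp add: mult.assoc)
  ultimately obtain e b where eb: "Z = e\<^sup>2" "X * W = b\<^sup>2"
    using coprime_mult_eq_square_int[of Z "X * W" k] assms(3,4) \<open>W > 0\<close> by auto
  define D where "D = gcd X N"
  have "D > 0" using assms(3) by (simp add: D_def)
  obtain x M where xM: "X = D * x" "N = D * M" "coprime x M"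
    using gcd_coprime_exists[of X N] \<open>D > 0\<close> unfolding D_def by (metis less_irrefl mult.commute)
  have pos: "x > 0" "M > 0" using xM assms(3,5) \<open>D > 0\<close> by (auto simp: zero_less_mult_iff)
  define V where "V = \<sigma> * (D * x\<^sup>2 - M * Z\<^sup>2)"
  have WV: "W = D * V" by (simp add: W_def V_def xM power2_eq_square algebra_simps)
  have "V > 0" using WV \<open>W > 0\<close> \<open>D > 0\<close> zero_less_mult_pos by blast
  have b2: "D\<^sup>2 * (x * V) = b\<^sup>2" using eb(2) WV xM by (simp add: power2_eq_square algebra_simps)
  then have "D dvd b" 
    using pow_divides_pow_iff[of 2 D b] by (metis dvd_triv_left zero_less_numeral)
  then obtain c where "b = D * c" by blast
  with b2 \<open>D > 0\<close> have c: "x * V = c\<^sup>2" by (simp add: power_mult_distrib)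
  have "coprime x Z" using \<open>coprime X Z\<close> xM by simp
  have "coprime x (D * x\<^sup>2 - M * Z\<^sup>2)"
  proof -
    have "gcd x (D * x\<^sup>2 - M * Z\<^sup>2) = gcd x (- (M * Z\<^sup>2))"
      using gcd_add_mult[of x "D * x" "- (M * Z\<^sup>2)"] by (simp add: power2_eq_square algebra_simps)
    moreover have "coprime x (- (M * Z\<^sup>2))" using \<open>coprime x Z\<close> xM(3) by simp
    ultimately show ?thesis by (simp only: coprime_iff_gcd_eq_1)
  qed
  then have "coprime x V" using \<sigma> by (auto simp: V_def)
  moreover note c
  ultimately obtain a w where aw: "x = a\<^sup>2" "V = w\<^sup>2"
    using coprime_mult_eq_square_int[of x V c] pos \<open>V > 0\<close> by auto
  have "coprime a e" using \<open>coprime x Z\<close> aw eb by simp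
  moreover have "w\<^sup>2 = \<sigma> * (D * a ^ 4 - M * e ^ 4)"
    using aw eb V_def by (simp add: power_mult[symmetric])
  moreover have "a \<noteq> 0" "e \<noteq> 0" using aw eb pos assms(4) by auto
  ultimately show ?thesis using that xM(2) \<open>D > 0\<close> pos by metis
qed

lemma square_mod_8_int: "(z::int)\<^sup>2 mod 8 \<in> {0, 1, 4}"
proof -
  have "z mod 8 \<in> {0..7}" by simp
  then have "z mod 8 \<in> {0,1,2,3,4,5,6,7}" by auto
  then have "(z mod 8)\<^sup>2 mod 8 \<in> {0, 1, 4}" by auto
  then show ?thesis by (simp add: power_mod)
qed

lemma odd_square_mod_8_int:
  assumes "odd (z::int)"
  shows "z\<^sup>2 mod 8 = 1"
proof -
  have *: "y mod 8 \<noteq> 0 \<and> y mod 8 \<noteq> 4" if "odd y" for y :: int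
    using that by presburger
  have "odd (z\<^sup>2)" using assms by simp
  from *[OF this] show ?thesis using square_mod_8_int[of z] by simp
qed

lemma odd_power4_mod_8_int: "odd (z::int) \<Longrightarrow> z ^ 4 mod 8 = 1"
  using odd_square_mod_8_int[of "z\<^sup>2"] by (simp flip: power_mult)

lemma power4_mod_8_int: "(z::int) ^ 4 mod 8 \<in> {0, 1}"
proof (cases "even z")
  case True
  then have "2 ^ 4 dvd z ^ 4" by (rule dvd_power_same)
  then have "(8::int) dvd z ^ 4" by (rule dvd_trans[rotated]) simp
  then show ?thesis by simp
qed (simp add: odd_power4_mod_8_int)

text \<open>
  The last two assumptions concern the homogeneous spaces of \<open>y\<^sup>2 = x\<^sup>3 - N x\<close> and of the 2-isogenous
  curve \<open>y\<^sup>2 = x\<^sup>3 + 4 N x\<close>. In the second, \<open>a\<close> must be odd because \<open>(a, e) = (0, 1)\<close> is a solution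
  for \<open>D = N\<close>.
\<close>

locale quartic_descent =
  fixes N :: int
  assumes N_pos: "N > 0"
    and N_squarefree: "squarefree N"
    and N_mod_8: "N mod 8 = 3"
    and minus_trivial:
      "\<lbrakk>D * M = N; D > 0; M > 0; coprime a e; w\<^sup>2 = D * a ^ 4 - M * e ^ 4\<rbrakk> \<Longrightarrow> D = 1"
    and plus_trivial:
      "\<lbrakk>D * M = N; D > 0; M > 0; coprime a e; odd a; w\<^sup>2 = D * a ^ 4 + 4 * M * e ^ 4\<rbrakk> \<Longrightarrow> D = 1"
begin

lemma even_if_quartic:
  assumes "w\<^sup>2 = a ^ 4 - N * e ^ 4"
  shows "even e"
proof (rule ccontr)
  assume "odd e"
  then have "(N * e ^ 4) mod 8 = 3"
    using N_mod_8 odd_power4_mod_8_int[of e] mod_mult_eq[of N 8 "e ^ 4"] by simp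
  then show False
    using square_mod_8_int[of w] power4_mod_8_int[of a] mod_diff_eq[of "a ^ 4" 8 "N * e ^ 4"]
    unfolding assms by auto
qed

lemma quartic_trivial:
  assumes "w\<^sup>2 = a ^ 4 - N * e ^ 4" "coprime a e"
  shows "e = 0"
  using assms
proof (induction "nat \<bar>e\<bar>" arbitrary: a e w rule: less_induct)
  case less
  show ?case
  proof (rule ccontr)
    assume "e \<noteq> 0"
    from even_if_quartic[OF less.prems(1)] obtain f where f: "e = 2 * f" by blast
    with \<open>e \<noteq> 0\<close> have "f \<noteq> 0" by simp
    have "odd a" "coprime a f" using less.prems(2) f by (auto simp: coprime_commute)
    then have "odd (w\<^sup>2)" using less.prems(1) f by simp
    then have "odd w" by simp
    then have "even (a\<^sup>2 - w)" "even (a\<^sup>2 + w)" using \<open>odd a\<close> by simp_all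
    then obtain X Y where X: "a\<^sup>2 - w = 2 * X" and Y: "a\<^sup>2 + w = 2 * Y" by (elim evenE)
    have "4 * (X * Y) = (a\<^sup>2 - w) * (a\<^sup>2 + w)" unfolding X Y by simp
    also have "\<dots> = a ^ 4 - w\<^sup>2" by (simp add: algebra_simps power2_eq_square power4_eq_xxxx)
    also have "\<dots> = 4 * (4 * N * f ^ 4)" using less.prems(1) f by (simp add: power_mult_distrib)
    finally have XY: "X * Y = 4 * N * f ^ 4" by simp
    have "X * Y > 0" unfolding XY using N_pos \<open>f \<noteq> 0\<close> by simp
    have sum: "X + Y = a\<^sup>2" using X Y by simp
    then have "X + Y \<ge> 0" by simp
    with \<open>X * Y > 0\<close> have pos: "X > 0" "Y > 0" by (auto simp: zero_less_mult_iff)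
    have "coprime (X + Y) (4 * f ^ 4)"
      unfolding sum using \<open>odd a\<close> \<open>coprime a f\<close> coprime_power_right_iff[of "a\<^sup>2" 2 2]
      by simp
    then have "coprime X Y"
      using coprime_if_squarefree[OF N_squarefree, of X Y "4 * f ^ 4"] XY by simp
    then obtain D M u v where DM: "D * M = 4 * N" "X = D * u ^ 4" "Y = M * v ^ 4" "u * v = \<bar>f\<bar>"
      "D > 0" "M > 0"
      by (rule coprime_mult_eq_mult_power_int[of X Y "4 * N" "\<bar>f\<bar>" 4])
        (use \<open>coprime X Y\<close> XY pos N_pos in \<open>auto simp: mult.assoc\<close>)
    have cop: "coprime D M" "coprime u v" "coprime u M" "coprime v D"
      using \<open>coprime X Y\<close> DM by (simp_all add: coprime_commute)
    have split: "\<exists>D' M' s t. D' * M' = N \<and> D' > 0 \<and> M' > 0 \<and> a\<^sup>2 = D' * s ^ 4 + 4 * M' * t ^ 4 \<and>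
        coprime s t \<and> odd s \<and> s * t = \<bar>f\<bar>"
      if "D * M = 4 * N" "a\<^sup>2 = D * u ^ 4 + M * v ^ 4" "u * v = \<bar>f\<bar>" "D > 0" "M > 0"
        "coprime u v" "coprime D M" "coprime u M" "even M" for D M u v :: int
    proof -
      have "odd D" using that(7,9) by auto
      then have "coprime 4 D" using coprime_power_left_iff[of 2 2 D] by simp
      then have "4 dvd M" using that(1) by (metis coprime_dvd_mult_right_iff dvd_triv_left)
      then obtain M' where M': "M = 4 * M'" by blast
      moreover have "odd u" using that(8,9) by auto
      ultimately show ?thesis using that by (intro exI[of _ D] exI[of _ M'] exI[of _ u] exI[of _ v]) auto
    qed
    have "even D \<or> even M" using DM(1) by (metis even_mult_iff even_numeral dvd_mult2)
    then obtain D' M' s t where st: "D' * M' = N" "D' > 0" "M' > 0"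
        "a\<^sup>2 = D' * s ^ 4 + 4 * M' * t ^ 4" "coprime s t" "odd s" "s * t = \<bar>f\<bar>"
      using split[of D M u v] split[of M D v u] DM cop sum
      by (auto simp: mult.commute coprime_commute add.commute)
    have "D' = 1" using plus_trivial st by blast
    with st(1,4) have a2: "a\<^sup>2 = s ^ 4 + 4 * N * t ^ 4" by simp
    have "even (\<bar>a\<bar> - s\<^sup>2)" "even (\<bar>a\<bar> + s\<^sup>2)" using \<open>odd a\<close> \<open>odd s\<close> by simp_all
    then obtain X' Y' where X': "\<bar>a\<bar> - s\<^sup>2 = 2 * X'" and Y': "\<bar>a\<bar> + s\<^sup>2 = 2 * Y'" by (elim evenE)
    have "4 * (X' * Y') = (\<bar>a\<bar> - s\<^sup>2) * (\<bar>a\<bar> + s\<^sup>2)" unfolding X' Y' by simp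
    also have "\<dots> = \<bar>a\<bar>\<^sup>2 - s ^ 4" by (simp add: algebra_simps power2_eq_square power4_eq_xxxx)
    also have "\<dots> = 4 * (N * t ^ 4)" using a2 by simp
    finally have XY': "X' * Y' = N * t ^ 4" by simp
    have "t \<noteq> 0" using st(7) \<open>f \<noteq> 0\<close> by auto
    then have "X' * Y' > 0" unfolding XY' using N_pos by simp
    moreover have "X' + Y' \<ge> 0" using X' Y' by simp
    ultimately have pos': "X' > 0" "Y' > 0" by (auto simp: zero_less_mult_iff)
    have diff: "Y' - X' = s\<^sup>2" using X' Y' by simp
    then have cop': "coprime X' Y'"
      using coprime_if_squarefree[OF N_squarefree, of X' Y' "t ^ 4"] XY' st(5) by simp
    then obtain D M u v where DM': "D * M = N" "X' = D * u ^ 4" "Y' = M * v ^ 4" "u * v = \<bar>t\<bar>"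
      "D > 0" "M > 0"
      by (rule coprime_mult_eq_mult_power_int[of X' Y' N "\<bar>t\<bar>" 4])
        (use cop' XY' pos' N_pos in auto)
    have "coprime v u" using cop' DM' by (simp add: coprime_commute)
    have s2: "s\<^sup>2 = M * v ^ 4 - D * u ^ 4" using diff DM' by simp
    have "M = 1"
      using minus_trivial[OF _ _ _ \<open>coprime v u\<close> s2] DM' by (simp add: mult.commute)
    with s2 DM'(1) have s2': "s\<^sup>2 = v ^ 4 - N * u ^ 4" by simp
    have "u \<noteq> 0" "v \<noteq> 0" using DM'(4) \<open>t \<noteq> 0\<close> by auto
    have "\<bar>u\<bar> \<le> \<bar>t\<bar>"
      using dvd_imp_le_int[of t u] \<open>t \<noteq> 0\<close> DM'(4) by (metis abs_dvd_iff dvd_abs_iff dvd_triv_left)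
    moreover have "\<bar>t\<bar> \<le> \<bar>f\<bar>"
      using dvd_imp_le_int[of f t] \<open>f \<noteq> 0\<close> st(7) by (metis abs_dvd_iff dvd_abs_iff dvd_triv_right)
    ultimately have "nat \<bar>u\<bar> < nat \<bar>e\<bar>" using f \<open>f \<noteq> 0\<close> by simp
    from less.hyps[OF this s2' \<open>coprime v u\<close>] \<open>u \<noteq> 0\<close> show False by simp
  qed
qed

end

lemma int_if_square_int:
  fixes r :: rat and n :: int
  assumes "r\<^sup>2 = of_int n"
  obtains k where "r = of_int k"
proof -
  obtain a b where ab: "quotient_of r = (a, b)" by (cases "quotient_of r")
  have r: "r = of_int a / of_int b" and "b > 0" and "coprime a b"
    using ab quotient_of_div quotient_of_denom_pos quotient_of_coprime by blast+
  have "of_int (a\<^sup>2) = (of_int (n * b\<^sup>2) :: rat)"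
    using assms \<open>b > 0\<close> unfolding r by (simp add: power_divide field_simps)
  then have "b dvd a\<^sup>2" by (metis of_int_eq_iff dvd_mult dvd_triv_left power2_eq_square)
  moreover have "coprime b (a\<^sup>2)" using \<open>coprime a b\<close> by (simp add: coprime_commute)
  ultimately have "is_unit b" by (metis coprime_common_divisor dvd_refl)
  then have "b = 1" using \<open>b > 0\<close> by simp
  with r that show ?thesis by simp
qed

context quartic_descent
begin

lemma cubic_x_eq_0:
  fixes x y :: rat
  assumes eq: "y\<^sup>2 = x ^ 3 - of_int N * x"
  shows "x = 0"
proof (rule ccontr)
  assume "x \<noteq> 0"
  obtain X Z where XZ: "quotient_of x = (X, Z)" by (cases "quotient_of x")
  have x: "x = of_int X / of_int Z" and "Z > 0" and cop: "coprime X Z"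
    using XZ quotient_of_div quotient_of_denom_pos quotient_of_coprime by blast+
  have "X \<noteq> 0" using x \<open>x \<noteq> 0\<close> by auto
  have "(y * of_int (Z\<^sup>2))\<^sup>2 = of_int (Z * (X * (X\<^sup>2 - N * Z\<^sup>2)))"
  proof -
    have X: "of_int X = x * of_int Z" using x \<open>Z > 0\<close> by simp
    have "(y * z\<^sup>2)\<^sup>2 = z * (x * z * ((x * z)\<^sup>2 - of_int N * z\<^sup>2))" for z :: rat
      by (simp add: power_mult_distrib eq) (simp add: algebra_simps power2_eq_square power3_eq_cube power4_eq_xxxx)
    then show ?thesis by (simp add: X)
  qed
  then obtain k where k: "y * of_int (Z\<^sup>2) = of_int k"
    and "(of_int k :: rat)\<^sup>2 = of_int (Z * (X * (X\<^sup>2 - N * Z\<^sup>2)))"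
    by (metis int_if_square_int)
  then have "(of_int (k\<^sup>2) :: rat) = of_int (Z * (X * (X\<^sup>2 - N * Z\<^sup>2)))" by simp
  then have k2: "k\<^sup>2 = Z * (X * (X\<^sup>2 - N * Z\<^sup>2))" by (simp only: of_int_eq_iff)
  have "k \<noteq> 0"
  proof
    assume "k = 0"
    with k2 \<open>X \<noteq> 0\<close> \<open>Z > 0\<close> have X2: "X\<^sup>2 = N * Z\<^sup>2" by simp
    then have "Z dvd X\<^sup>2" by (simp add: power2_eq_square)
    moreover have "coprime Z (X\<^sup>2)" using cop by (simp add: coprime_commute)
    ultimately have "is_unit Z" by (metis coprime_common_divisor dvd_refl)
    with \<open>Z > 0\<close> have "Z = 1" by simp
    with X2 N_mod_8 square_mod_8_int[of X] show False by simp
  qed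
  show False
  proof (cases "X > 0")
    case True
    have "Z * (X * (1 * (X\<^sup>2 - N * Z\<^sup>2))) = k\<^sup>2" using k2 by simp
    then obtain D M a e w where *: "D * M = N" "D > 0" "M > 0" "coprime a e" "e \<noteq> 0"
        "w\<^sup>2 = 1 * (D * a ^ 4 - M * e ^ 4)"
      using \<open>k \<noteq> 0\<close> True \<open>Z > 0\<close> N_pos cop by (rule quartic_from_cubic) blast+
    then have "D = 1" using minus_trivial[of D M a e w] by simp
    then show False using quartic_trivial[of w a e] * by simp
  next
    case False
    then have "- X > 0" using \<open>X \<noteq> 0\<close> by simp
    have "Z * (- X * (- 1 * ((- X)\<^sup>2 - N * Z\<^sup>2))) = k\<^sup>2"
      using k2 by (simp add: algebra_simps)
    then obtain D M a e w where *: "D * M = N" "D > 0" "M > 0" "coprime a e" "a \<noteq> 0"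
        "w\<^sup>2 = - 1 * (D * a ^ 4 - M * e ^ 4)"
      using \<open>k \<noteq> 0\<close> \<open>- X > 0\<close> \<open>Z > 0\<close> N_pos
      by (rule quartic_from_cubic) (use cop in \<open>simp_all\<close>)
    then have "M = 1"
      using minus_trivial[of M D e a w] by (simp add: mult.commute coprime_commute)
    then show False using quartic_trivial[of w e a] * by (simp add: coprime_commute)
  qed
qed

lemma ec_points_eq: "ec_points (- of_int N :: rat) 0 = {Infinity, Affine 0 0}"
  using cubic_x_eq_0 by (fastforce simp: ec_points_def)

lemma ec_rank_eq_0: "ec_rank (- of_int N :: rat) 0 = 0"
proof -
  let ?G = "ec_group (- of_int N :: rat) 0"
  have carrier: "carrier ?G = {Infinity, Affine 0 0}"
    by (simp add: ec_group_def ec_points_eq)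
  have "group ?G"
    by (rule groupI) (simp_all add: carrier, auto simp: ec_group_def)
  moreover have "\<exists>n::nat. n > 0 \<and> P [^]\<^bsub>?G\<^esub> n = \<one>\<^bsub>?G\<^esub>" if "P \<in> carrier ?G" for P
    using that unfolding carrier
    by (intro exI[of _ 2]) (auto simp: ec_group_def nat_pow_def numeral_2_eq_2)
  ultimately show ?thesis
    unfolding ec_rank_def by (rule group_rank_eq_0_if_torsion)
qed

end

lemma prime_mult_split:
  fixes D M r K :: int
  assumes "prime r" "D * M = r * K"
  obtains D' where "D = r * D'" "D' * M = K" | M' where "M = r * M'" "D * M' = K"
proof -
  have "r dvd D * M" using assms(2) by simp
  then have "r dvd D \<or> r dvd M" using assms(1) prime_dvd_mult_iff by blast
  moreover have "r \<noteq> 0" using assms(1) by auto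
  ultimately show ?thesis using assms(2) that by (auto elim!: dvdE)
qed

lemma prime_mult_cases:
  fixes D M r K :: int
  assumes "prime r" "D * M = r * K" "D > 0"
    and cases: "\<And>D M. D * M = K \<Longrightarrow> D > 0 \<Longrightarrow> (D, M) \<in> S"
  shows "(D, M) \<in> (\<lambda>(d, m). (r * d, m)) ` S \<union> (\<lambda>(d, m). (d, r * m)) ` S"
  using assms(1,2)
proof (rule prime_mult_split)
  fix D'
  assume D': "D = r * D'" "D' * M = K"
  have "D' > 0" using D'(1) \<open>D > 0\<close> prime_gt_0_int[OF assms(1)] zero_less_mult_pos by blast
  from cases[OF D'(2) this] show ?thesis
    by (intro UnI1 image_eqI[where x = "(D', M)"]) (simp_all add: D'(1))
next
  fix M'
  assume M': "M = r * M'" "D * M' = K"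
  from cases[OF M'(2) \<open>D > 0\<close>] show ?thesis
    by (intro UnI2 image_eqI[where x = "(D, M')"]) (simp_all add: M'(1))
qed

lemma three_primes_mult_cases:
  fixes D M p q r :: int
  assumes "prime p" "prime q" "prime r" "D * M = r * p * q" "D > 0"
  shows "(D, M) \<in> {(1, r * p * q), (r, p * q), (p, r * q), (q, r * p),
    (r * p, q), (r * q, p), (p * q, r), (r * p * q, 1)}"
proof -
  have 0: "(D, M) \<in> {(1, 1)}" if "D * M = 1" "D > 0" for D M :: int
    using that by (simp add: pos_zmult_eq_1_iff)
  have 1: "(D, M) \<in> {(q, 1), (1, q)}" if "D * M = q" "D > 0" for D M
    using prime_mult_cases[OF \<open>prime q\<close> _ that(2) 0, of M 1] that by auto
  have 2: "(D, M) \<in> {(p * q, 1), (p, q), (q, p), (1, p * q)}" if "D * M = p * q" "D > 0" for D M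
    using prime_mult_cases[OF \<open>prime p\<close> that 1] by auto
  let ?S = "{(p * q, 1), (p, q), (q, p), (1, p * q)}"
  have "D * M = r * (p * q)" using assms(4) by simp
  then have "(D, M) \<in> (\<lambda>(d, m). (r * d, m)) ` ?S \<union> (\<lambda>(d, m). (d, r * m)) ` ?S"
    using \<open>D > 0\<close> by (rule prime_mult_cases[OF \<open>prime r\<close>]) (rule 2)
  then show ?thesis
    unfolding image_insert image_empty prod.case mult.assoc mult_1_right insert_iff Un_iff empty_iff
    by argo
qed

lemma not_QuadRes_5:
  assumes "x mod 5 = 2 \<or> x mod 5 = 3"
  shows "\<not> QuadRes 5 x"
proof
  assume "QuadRes 5 x"
  then obtain y where "y\<^sup>2 mod 5 = x mod 5" by (auto simp: QuadRes_def cong_def)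
  moreover have "y mod 5 \<in> {0..4}" by simp
  then have "y mod 5 \<in> {0,1,2,3,4}" by auto
  then have "(y mod 5)\<^sup>2 mod 5 \<in> {0, 1, 4}" by auto
  then have "y\<^sup>2 mod 5 \<in> {0, 1, 4}" by (simp add: power_mod)
  ultimately show False using assms by auto
qed

lemma QuadRes_mult_square_cancel:
  fixes l c x :: int
  assumes "QuadRes l (c\<^sup>2 * x)" "coprime c l"
  shows "QuadRes l x"
proof -
  obtain y where y: "[y\<^sup>2 = c\<^sup>2 * x] (mod l)" using assms(1) by (auto simp: QuadRes_def)
  obtain d where d: "[c * d = 1] (mod l)" using cong_solve_coprime_int[OF assms(2)] by blast
  have "[y\<^sup>2 * d\<^sup>2 = c\<^sup>2 * x * d\<^sup>2] (mod l)" using y by (intro cong_mult) auto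
  also have "c\<^sup>2 * x * d\<^sup>2 = (c * d)\<^sup>2 * x" by (simp add: power_mult_distrib)
  also have "[\<dots> = 1\<^sup>2 * x] (mod l)" using d by (intro cong_mult cong_pow) auto
  finally have "[(y * d)\<^sup>2 = x] (mod l)" by (simp add: power_mult_distrib)
  then show ?thesis unfolding QuadRes_def by blast
qed

lemma QuadRes_minus_one_iff:
  assumes "prime p" "p > 2"
  shows "QuadRes (int p) (- 1) \<longleftrightarrow> [p = 1] (mod 4)"
proof -
  have "odd p" using assms prime_odd_nat by simp
  then obtain m where m: "p = 2 * m + 1" by (elim oddE)
  then have even_iff: "even ((p - 1) div 2) \<longleftrightarrow> [p = 1] (mod 4)"
    using dvd_mult_cancel_left[of 2 2 m]
    by (simp add: cong_altdef_nat)
  have n1: "\<not> [1 = - 1] (mod int p)" "\<not> [- 1 = 1] (mod int p)"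
    using assms zdvd_imp_le[of "int p" 2] by (auto simp: cong_iff_dvd_diff)
  have n0: "\<not> [- 1 = 0] (mod int p)"
    using assms by (simp add: cong_iff_dvd_diff)
  have "[Legendre (- 1) (int p) = (- 1) ^ ((p - 1) div 2)] (mod int p)"
    using euler_criterion assms by blast
  then show ?thesis
    using n0 n1 even_iff by (cases "even ((p - 1) div 2)") (auto simp: Legendre_def split: if_splits)
qed

lemma not_QuadRes_5_prime:
  assumes "prime p" "[p = 33] (mod 40)"
  shows "\<not> QuadRes (int p) 5"
proof -
  have "p mod 40 = 33" using assms(2) by (simp add: cong_def)
  then obtain k where k: "p = 40 * k + 33" by (metis mult_div_mod_eq)
  then have "p > 2" "p \<noteq> 5" by simp_all
  have m5: "int p mod 5 = 3" using mod_mod_cancel[of 5 40 "int p"] by (simp add: k)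
  have "(p - 1) div 2 = 2 * (10 * k + 8)" unfolding k by simp
  then have ev: "even ((p - 1) div 2)" by simp
  have "prime (5::nat)" by simp
  have "Legendre (int p) 5 * Legendre 5 (int p) = (-1::int) ^ ((p - 1) div 2 * ((5 - 1) div 2))"
    using Quadratic_Reciprocity[of p 5] assms(1) \<open>p > 2\<close> \<open>p \<noteq> 5\<close> \<open>prime 5\<close> by simp
  also have "\<dots> = 1" using ev by simp
  finally have "Legendre (int p) 5 * Legendre 5 (int p) = 1" .
  moreover have "Legendre (int p) 5 = - 1"
    using m5 not_QuadRes_5[of "int p"] by (simp add: Legendre_def cong_def)
  ultimately show ?thesis by (auto simp: Legendre_def split: if_splits)
qed

lemma quartic_descent_pq:
  fixes p q :: nat
  assumes "prime p" and "prime q" and "p \<noteq> q"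
    and "[p = 33] (mod 40)" and "[q = 7] (mod 40)"
  shows "quartic_descent (5 * int p * int q)"
proof -
  let ?P = "int p" and ?Q = "int q"
  have "p mod 40 = 33" "q mod 40 = 7" using assms by (simp_all add: cong_def)
  then obtain k m where k: "p = 40 * k + 33" and m: "q = 40 * m + 7" by (metis mult_div_mod_eq)
  have P: "prime ?P" and Q: "prime ?Q" using assms by simp_all
  have five: "prime (5::int)" by simp
  have gt: "p > 5" "q > 5" using k m by simp_all
  have m40: "x mod 5 = r mod 5 \<and> x mod 8 = r mod 8" if "x mod 40 = r" for x r :: int
    using that by (auto simp: mod_mod_cancel)
  have m40_nat: "x mod 4 = r mod 4" if "x mod 40 = r" for x r :: nat
    using that by (auto simp: mod_mod_cancel)
  have "?P mod 40 = 33" "?Q mod 40 = 7" unfolding k m by simp_all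
  from this[THEN m40] have Pm: "?P mod 5 = 3" "?P mod 8 = 1" and Qm: "?Q mod 5 = 2" "?Q mod 8 = 7"
    by simp_all
  have ndvd: "\<not> r dvd s" if "prime r" "prime s" "r \<noteq> s" for r s :: int
    using that primes_dvd_imp_eq by blast
  have nd: "\<not> ?P dvd ?Q" "\<not> ?Q dvd ?P" "\<not> ?P dvd 5" "\<not> ?Q dvd 5" "\<not> 5 dvd ?P" "\<not> 5 dvd ?Q"
    using ndvd[OF P Q] ndvd[OF Q P] ndvd[OF P five] ndvd[OF Q five] ndvd[OF five P] ndvd[OF five Q]
      assms(3) gt by simp_all
  have "\<not> ?P dvd 2" using ndvd[OF P, of 2] gt by simp
  then have ndP4: "\<not> ?P dvd 4" using prime_dvd_power[OF P, of 2 2] by auto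
  have neg5: "(- x) mod 5 = 3 \<and> (4 * x) mod 5 = 3" if "x mod 5 = 2" for x :: int
    using that mod_minus_eq[of x 5] mod_mult_right_eq[of 4 x 5] by auto
  have neg5': "(- x) mod 5 = 2 \<and> (4 * x) mod 5 = 2" if "x mod 5 = 3" for x :: int
    using that mod_minus_eq[of x 5] mod_mult_right_eq[of 4 x 5] by auto
  have r5: "\<not> QuadRes 5 ?P" "\<not> QuadRes 5 (- ?P)" "\<not> QuadRes 5 (4 * ?P)"
    using Pm(1) neg5'[OF Pm(1)] not_QuadRes_5 by blast+
  have s5: "\<not> QuadRes 5 ?Q" "\<not> QuadRes 5 (- ?Q)" "\<not> QuadRes 5 (4 * ?Q)"
    using Qm(1) neg5[OF Qm(1)] not_QuadRes_5 by blast+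
  have rP5: "\<not> QuadRes ?P 5" using not_QuadRes_5_prime assms by blast
  have rP20: "\<not> QuadRes ?P 20"
  proof -
    have "coprime 2 ?P" by (simp add: k)
    then show ?thesis using QuadRes_mult_square_cancel[of ?P 2 5] rP5 by auto
  qed
  have rPm5: "\<not> QuadRes ?P (- 5)"
  proof
    assume "QuadRes ?P (- 5)"
    have "[p = 1] (mod 4)" using m40_nat[of p 33] by (simp add: k cong_def)
    then have "QuadRes ?P (- 1)" using QuadRes_minus_one_iff assms(1) gt by simp
    then obtain i where i: "[i\<^sup>2 = - 1] (mod ?P)" by (auto simp: QuadRes_def)
    obtain y where y: "[y\<^sup>2 = - 5] (mod ?P)" using \<open>QuadRes ?P (- 5)\<close> by (auto simp: QuadRes_def)
    have "[(i * y)\<^sup>2 = (- 1) * (- 5)] (mod ?P)"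
      unfolding power_mult_distrib using i y by (rule cong_mult)
    then have "QuadRes ?P 5" unfolding QuadRes_def by auto
    with rP5 show False ..
  qed
  have rQm1: "\<not> QuadRes ?Q (- 1)"
  proof -
    have "\<not> [q = 1] (mod 4)" using m40_nat[of q 7] by (simp add: m cong_def)
    then show ?thesis using QuadRes_minus_one_iff assms(2) gt by simp
  qed
  have N_mod_8: "(5 * ?P * ?Q) mod 8 = 3"
  proof -
    have "(5 * ?P * ?Q) mod 8 = (5 * (?P mod 8) * (?Q mod 8)) mod 8"
      by (metis mod_mult_left_eq mod_mult_right_eq)
    then show ?thesis using Pm Qm by simp
  qed
  show ?thesis
  proof
    show "5 * ?P * ?Q > 0" using gt by simp
    show "squarefree (5 * ?P * ?Q)"
      using P Q five nd
      by (intro squarefree_mult_coprime)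
        (auto intro: squarefree_prime prime_imp_coprime simp: prime_imp_coprime coprime_commute)
    show "(5 * ?P * ?Q) mod 8 = 3" by (fact N_mod_8)
  next
    fix D M a e w :: int
    assume DM: "D * M = 5 * ?P * ?Q" "D > 0" "M > 0" and cop: "coprime a e"
      and w: "w\<^sup>2 = D * a ^ 4 - M * e ^ 4"
    have cop': "coprime e a" using cop by (simp add: coprime_commute)
    note no = no_quartic_if_nonresidue[OF _ _ cop] no_quartic_if_nonresidue[OF _ _ cop']
    have "(D, M) \<in> {(1, 5 * ?P * ?Q), (5, ?P * ?Q), (?P, 5 * ?Q), (?Q, 5 * ?P),
        (5 * ?P, ?Q), (5 * ?Q, ?P), (?P * ?Q, 5), (5 * ?P * ?Q, 1)}"
      using three_primes_mult_cases[OF P Q five DM(1,2)] .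
    moreover have "\<not> (D = 5 \<and> M = ?P * ?Q)"
      using no(1)[of ?P w 5 "- ?Q"] P w nd rP5 by auto
    moreover have "\<not> (D = ?P \<and> M = 5 * ?Q)"
      using no(1)[of 5 w ?P "- ?Q"] five w nd r5 s5 by auto
    moreover have "\<not> (D = ?Q \<and> M = 5 * ?P)"
      using no(1)[of 5 w ?Q "- ?P"] five w nd r5 s5 by auto
    moreover have "\<not> (D = 5 * ?P \<and> M = ?Q)"
      using no(2)[of 5 w "- ?Q" "?P"] five w nd r5 s5 by auto
    moreover have "\<not> (D = 5 * ?Q \<and> M = ?P)"
      using no(2)[of 5 w "- ?P" "?Q"] five w nd r5 s5 by auto
    moreover have "\<not> (D = ?P * ?Q \<and> M = 5)"
      using no(2)[of ?P w "- 5" "?Q"] P w nd rPm5 by auto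
    moreover have "\<not> (D = 5 * ?P * ?Q \<and> M = 1)"
      using no(2)[of ?Q w "- 1" "5 * ?P"] Q w nd rQm1 by (auto simp: prime_dvd_mult_iff ac_simps)
    ultimately show "D = 1" by auto
  next
    fix D M a e w :: int
    assume DM: "D * M = 5 * ?P * ?Q" "D > 0" "M > 0" and cop: "coprime a e" and "odd a"
      and w: "w\<^sup>2 = D * a ^ 4 + 4 * M * e ^ 4"
    have cop': "coprime e a" using cop by (simp add: coprime_commute)
    note no = no_quartic_if_nonresidue[OF _ _ cop] no_quartic_if_nonresidue[OF _ _ cop']
    have nd4: "\<not> ?P dvd 4 * ?Q" "\<not> 5 dvd 4 * ?P" "\<not> 5 dvd 4 * ?Q"
      using P five nd ndP4 prime_dvd_mult_iff[of 5 4 ?P] prime_dvd_mult_iff[of 5 4 ?Q]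
      by (simp_all add: prime_dvd_mult_iff)
    have "(D, M) \<in> {(1, 5 * ?P * ?Q), (5, ?P * ?Q), (?P, 5 * ?Q), (?Q, 5 * ?P),
        (5 * ?P, ?Q), (5 * ?Q, ?P), (?P * ?Q, 5), (5 * ?P * ?Q, 1)}"
      using three_primes_mult_cases[OF P Q five DM(1,2)] .
    moreover have "\<not> (D = 5 \<and> M = ?P * ?Q)"
      using no(1)[of ?P w 5 "4 * ?Q"] P w nd4 rP5 by (auto simp: ac_simps)
    moreover have "\<not> (D = ?P \<and> M = 5 * ?Q)"
      using no(1)[of 5 w ?P "4 * ?Q"] five w nd4 r5 s5 by (auto simp: ac_simps)
    moreover have "\<not> (D = ?Q \<and> M = 5 * ?P)"
      using no(1)[of 5 w ?Q "4 * ?P"] five w nd4 r5 s5 by (auto simp: ac_simps)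
    moreover have "\<not> (D = 5 * ?P \<and> M = ?Q)"
      using no(2)[of 5 w "4 * ?Q" "?P"] five w nd r5 s5 by auto
    moreover have "\<not> (D = 5 * ?Q \<and> M = ?P)"
      using no(2)[of 5 w "4 * ?P" "?Q"] five w nd r5 s5 by auto
    moreover have "\<not> (D = ?P * ?Q \<and> M = 5)"
      using no(2)[of ?P w "20" "?Q"] P w nd rP20 by auto
    moreover have "\<not> (D = 5 * ?P * ?Q \<and> M = 1)"
    proof
      assume *: "D = 5 * ?P * ?Q \<and> M = 1"
      have "D mod 4 = 3" using * N_mod_8 by (simp only:) presburger
      moreover have "a ^ 4 mod 4 = 1" using odd_power4_mod_8_int[OF \<open>odd a\<close>] by presburger
      ultimately have "(D * a ^ 4) mod 4 = 3" using mod_mult_eq[of D 4 "a ^ 4"] by simp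
      then have "w\<^sup>2 mod 4 = 3" unfolding w by (simp add: mult.assoc)
      then show False using square_mod_8_int[of w] by (auto, presburger+)
    qed
    ultimately show "D = 1" by auto
  qed
qed

theorem theorem1p1:
  fixes p q :: nat
  assumes "prime p" and "prime q" and "p \<noteq> q"
    and "[p = 33] (mod 40)" and "[q = 7] (mod 40)"
  shows "ec_rank (- (5 * of_nat p * of_nat q) :: rat) 0 = 0"
proof -
  interpret quartic_descent "5 * int p * int q"
    using assms by (rule quartic_descent_pq)
  show ?thesis using ec_rank_eq_0 by simp
qed

end
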